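(* There is a polynomial $p$ (an absolute one, independent of $n$, $f$ and $\epsilon$) such that for every $n\ge 1$, every threshold function $f:\{-1,1\}^n\to\{-1,1\}$ and every $\epsilon\in(0,1)$, there is a threshold function $g:\{-1,1\}^n\to\{-1,1\}$ which is a $J$-junta for $J=\mathrm{Inf}(f)^2\cdot p(1/\epsilon)$ and satisfies $\Pr_{x}[f(x)\ne g(x)]\le \epsilon$, where $x$ is uniform over $\{-1,1\}^n$.
   Context: A threshold function is a function $f:\{-1,1\}^n\to\{-1,1\}$ of the form $f(x)=\mathrm{sign}(w\cdot x-\theta)$ with arbitrary real weights $w_1,\dots,w_n$ and real threshold $\theta$; here $\mathrm{sign}(t)=1$ for $t\ge 0$ and $-1$ for $t<0$. The influence of coordinate $i$ on $f$ is $\mathrm{Inf}_i(f)=\Pr_x[f(x)\ne f(x^{\oplus i})]$, where $x$ is uniform on $\{-1,1\}^n$ and $x^{\oplus i}$ is $x$ with the $i$-th coordinate flipped; the total influence is $\mathrm{Inf}(f)=\sum_{i=1}^n \mathrm{Inf}_i(f)$. For a real $J\ge 0$, a function is a $J$-junta if it depends only on the coordinates in some set of cardinality at most $J$. *)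

theory Defs
  imports "HOL-Probability.Probability" "HOL-Computational_Algebra.Polynomial"
begin

(* The dimension n has to be quantified inside the statement, below the choice of the
   polynomial, so a point of the n-dimensional cube is a function on the indices
   {..<n} (coordinates are numbered from 0), extended by undefined elsewhere. *)
definition cube :: "nat \<Rightarrow> (nat \<Rightarrow> real) set" where
  "cube n = {..<n} \<rightarrow>\<^sub>E {-1, 1}"

lemma finite_cube: "finite (cube n)"
  unfolding cube_def by (intro finite_PiE) auto

(* With finite_cube this makes pmf_of_set (cube n) the uniform distribution. *)
lemma cube_nonempty: "cube n \<noteq> {}"
  unfolding cube_def by (simp add: PiE_eq_empty_iff)

(* Unlike the library's sgn, this takes the value 1 at 0. *)
definition pm_sign :: "real \<Rightarrow> real" where
  "pm_sign t = (if t \<ge> 0 then 1 else -1)"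

(* Only the values of f on cube n matter, here and in the definitions below. *)
definition threshold_function :: "nat \<Rightarrow> ((nat \<Rightarrow> real) \<Rightarrow> real) \<Rightarrow> bool" where
  "threshold_function n f \<longleftrightarrow>
     (\<exists>(w :: nat \<Rightarrow> real) (\<theta> :: real). \<forall>x\<in>cube n. f x = pm_sign ((\<Sum>i<n. w i * x i) - \<theta>))"

definition flip :: "nat \<Rightarrow> (nat \<Rightarrow> real) \<Rightarrow> nat \<Rightarrow> real" where
  "flip i x = x(i := - x i)"

definition influence :: "nat \<Rightarrow> ((nat \<Rightarrow> real) \<Rightarrow> real) \<Rightarrow> nat \<Rightarrow> real" where
  "influence n f i = measure_pmf.prob (pmf_of_set (cube n)) {x. f x \<noteq> f (flip i x)}"

definition total_influence :: "nat \<Rightarrow> ((nat \<Rightarrow> real) \<Rightarrow> real) \<Rightarrow> real" where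
  "total_influence n f = (\<Sum>i<n. influence n f i)"

definition junta :: "nat \<Rightarrow> real \<Rightarrow> ((nat \<Rightarrow> real) \<Rightarrow> real) \<Rightarrow> bool" where
  "junta n J f \<longleftrightarrow>
     (\<exists>S \<subseteq> {..<n}. real (card S) \<le> J \<and>
        (\<forall>x\<in>cube n. \<forall>y\<in>cube n. (\<forall>i\<in>S. x i = y i) \<longrightarrow> f x = f y))"

end

theory Submission
  imports Defs
begin

text \<open>Write \<open>I\<close> for the total influence of \<open>f = sign(w x - \<theta>)\<close> and put \<open>\<tau> = \<epsilon> / (16 I)\<close>. Starting from
  the empty head, keep adding a coordinate whose weight exceeds \<open>\<tau>\<close> times the Euclidean norm \<open>\<sigma>\<close>
  of the weights outside the head, and let \<open>g\<close> be the threshold function with the same \<open>\<theta>\<close> and only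
  the weights of the head.

  If this stops, all tail weights are at most \<open>\<tau> \<sigma>\<close>. The correlation of \<open>f\<close> with the tail sum is then
  at most \<open>\<tau> \<sigma> I\<close>, but it is also at least a constant times \<open>\<sigma> Pr[f \<noteq> g]\<close>; so \<open>Pr[f \<noteq> g] \<le> 16 \<tau> I\<close>.
  In particular a tiny \<open>I\<close> makes \<open>f\<close> close to a constant.

  If it still runs after \<open>m B\<close> steps, every head weight is at least \<open>\<tau> \<sigma>\<close> for the final \<open>\<sigma>\<close>, so the head
  splits into \<open>m\<close> blocks of norm at least \<open>\<tau> \<sigma> sqrt B\<close>. With \<open>m\<close> of order \<open>1 / \<epsilon>\<^sup>2\<close> and \<open>B\<close> of order
  \<open>1 / (\<epsilon> \<tau>\<^sup>2)\<close>, a Littlewood--Offord argument keeps the head form away from \<open>\<theta>\<close> by more than the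
  tail can contribute, except with probability \<open>\<epsilon>\<close>.\<close>

section \<open>Averages over the cube\<close>

definition cube_mean :: "nat \<Rightarrow> ((nat \<Rightarrow> real) \<Rightarrow> real) \<Rightarrow> real" where
  "cube_mean n F = (\<Sum>x\<in>cube n. F x) / real (card (cube n))"

lemma card_cube_pos: "real (card (cube n)) > 0"
  using finite_cube cube_nonempty by (simp add: card_gt_0_iff)

text \<open>The bridge from the probabilities in the theorem to finite averages, so that no
  measurability or integrability conditions arise.\<close>

lemma prob_cube_eq_mean:
  "measure_pmf.prob (pmf_of_set (cube n)) {x. P x} = cube_mean n (\<lambda>x. of_bool (P x))"
proof -
  have "(\<Sum>x\<in>cube n. of_bool (P x) :: real) = real (card (cube n \<inter> {x. P x}))"
    using finite_cube[of n] by (simp add: Int_def)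
  then show ?thesis
    by (simp add: measure_pmf_of_set finite_cube cube_nonempty cube_mean_def)
qed

lemma cube_mean_cong: "(\<And>x. x \<in> cube n \<Longrightarrow> F x = G x) \<Longrightarrow> cube_mean n F = cube_mean n G"
  by (simp add: cube_mean_def)

lemma cube_mean_mono: "(\<And>x. x \<in> cube n \<Longrightarrow> F x \<le> G x) \<Longrightarrow> cube_mean n F \<le> cube_mean n G"
  unfolding cube_mean_def by (intro divide_right_mono sum_mono) auto

lemma cube_mean_const [simp]: "cube_mean n (\<lambda>x. c) = c"
  using card_cube_pos[of n] by (simp add: cube_mean_def)

lemma cube_mean_add: "cube_mean n (\<lambda>x. F x + G x) = cube_mean n F + cube_mean n G"
  by (simp add: cube_mean_def sum.distrib add_divide_distrib)

lemma cube_mean_diff: "cube_mean n (\<lambda>x. F x - G x) = cube_mean n F - cube_mean n G"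
  by (simp add: cube_mean_def sum_subtractf diff_divide_distrib)

lemma cube_mean_cmult: "cube_mean n (\<lambda>x. c * F x) = c * cube_mean n F"
  by (simp add: cube_mean_def flip: sum_distrib_left)

lemma cube_mean_divide: "cube_mean n (\<lambda>x. F x / c) = cube_mean n F / c"
  using cube_mean_cmult[of n "inverse c" F] by (simp add: field_simps)

lemma cube_mean_minus: "cube_mean n (\<lambda>x. - F x) = - cube_mean n F"
  by (simp add: cube_mean_def sum_negf)

lemma cube_mean_sum: "cube_mean n (\<lambda>x. \<Sum>i\<in>I. F i x) = (\<Sum>i\<in>I. cube_mean n (F i))"
  unfolding cube_mean_def by (subst sum.swap) (simp add: sum_divide_distrib)

lemma cube_mean_square_ge: "(cube_mean n F)\<^sup>2 \<le> cube_mean n (\<lambda>x. (F x)\<^sup>2)"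
proof -
  let ?c = "cube_mean n F"
  have "0 \<le> cube_mean n (\<lambda>x. (F x - ?c)\<^sup>2)"
    using cube_mean_mono[of n "\<lambda>x. 0" "\<lambda>x. (F x - ?c)\<^sup>2"] by simp
  also have "(\<lambda>x. (F x - ?c)\<^sup>2) = (\<lambda>x. (F x)\<^sup>2 - 2 * ?c * F x + ?c\<^sup>2)"
    by (auto simp: power2_eq_square algebra_simps)
  finally show ?thesis
    by (simp add: cube_mean_add cube_mean_diff cube_mean_cmult power2_eq_square)
qed

text \<open>Jensen moves the square inside the mean, where the bounded factor \<open>\<phi>\<close>
  drops out; after expansion only the diagonal survives, contributing at most 1 per index.\<close>

lemma cube_mean_correlation_le:
  assumes "finite I"
    and bound: "\<And>i x. i \<in> I \<Longrightarrow> x \<in> cube n \<Longrightarrow> \<bar>Y i x\<bar> \<le> 1"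
    and uncorrelated: "\<And>i j. i \<in> I \<Longrightarrow> j \<in> I \<Longrightarrow> i \<noteq> j \<Longrightarrow> cube_mean n (\<lambda>x. Y i x * Y j x) = 0"
    and \<phi>: "\<And>x. x \<in> cube n \<Longrightarrow> \<bar>\<phi> x\<bar> \<le> 1"
  shows "cube_mean n (\<lambda>x. \<phi> x * (\<Sum>i\<in>I. Y i x)) \<le> sqrt (card I)"
proof -
  have "(cube_mean n (\<lambda>x. \<phi> x * (\<Sum>i\<in>I. Y i x)))\<^sup>2
      \<le> cube_mean n (\<lambda>x. (\<phi> x * (\<Sum>i\<in>I. Y i x))\<^sup>2)"
    by (rule cube_mean_square_ge)
  also have "\<dots> \<le> cube_mean n (\<lambda>x. \<Sum>i\<in>I. \<Sum>j\<in>I. Y i x * Y j x)"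
  proof (rule cube_mean_mono)
    fix x assume "x \<in> cube n"
    then have "(\<phi> x)\<^sup>2 \<le> 1" using \<phi> by (simp add: abs_square_le_1)
    then have "(\<phi> x)\<^sup>2 * (\<Sum>i\<in>I. Y i x)\<^sup>2 \<le> 1 * (\<Sum>i\<in>I. Y i x)\<^sup>2"
      by (intro mult_right_mono) auto
    then show "(\<phi> x * (\<Sum>i\<in>I. Y i x))\<^sup>2 \<le> (\<Sum>i\<in>I. \<Sum>j\<in>I. Y i x * Y j x)"
      by (simp only: power_mult_distrib sum_product[symmetric] power2_eq_square[symmetric] mult_1)
  qed
  also have "\<dots> = (\<Sum>i\<in>I. \<Sum>j\<in>I. cube_mean n (\<lambda>x. Y i x * Y j x))"
    by (simp add: cube_mean_sum)
  also have "\<dots> \<le> (\<Sum>i\<in>I. \<Sum>j\<in>I. of_bool (i = j))"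
  proof (intro sum_mono)
    fix i j assume ij: "i \<in> I" "j \<in> I"
    have "cube_mean n (\<lambda>x. Y i x * Y i x) \<le> cube_mean n (\<lambda>x. 1)"
      using bound[OF ij(1)] by (intro cube_mean_mono) (simp add: abs_square_le_1 flip: power2_eq_square)
    then show "cube_mean n (\<lambda>x. Y i x * Y j x) \<le> of_bool (i = j)"
      using uncorrelated[OF ij] by (cases "i = j") auto
  qed
  also have "\<dots> = real (card I)"
    using \<open>finite I\<close> by (simp add: of_bool_def)
  finally show ?thesis
    by (rule real_le_rsqrt)
qed

section \<open>Flips and independence\<close>

definition flip_on :: "nat set \<Rightarrow> (nat \<Rightarrow> real) \<Rightarrow> nat \<Rightarrow> real" where
  "flip_on S x = (\<lambda>i. if i \<in> S then - x i else x i)"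

lemma flip_on_flip_on [simp]: "flip_on S (flip_on S x) = x"
  by (auto simp: flip_on_def)

lemma flip_eq_flip_on: "flip i x = flip_on {i} x"
  by (auto simp: flip_def flip_on_def)

lemma cube_coord: "x \<in> cube n \<Longrightarrow> i < n \<Longrightarrow> x i \<in> {-1, 1}"
  unfolding cube_def using PiE_mem[of x "{..<n}" "\<lambda>_. {-1, 1}" i] by simp

lemma flip_on_cube:
  assumes "S \<subseteq> {..<n}" "x \<in> cube n"
  shows "flip_on S x \<in> cube n"
  unfolding cube_def
proof (rule PiE_I)
  show "flip_on S x i \<in> {-1, 1}" if "i \<in> {..<n}" for i
    using cube_coord[OF assms(2), of i] that by (auto simp: flip_on_def)
  show "flip_on S x i = undefined" if "i \<notin> {..<n}" for i
  proof -
    have "x i = undefined"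
      using assms(2) that unfolding cube_def by (rule PiE_arb)
    moreover have "i \<notin> S" using assms(1) that by blast
    ultimately show ?thesis by (simp add: flip_on_def)
  qed
qed

lemma cube_coord_square: "x \<in> cube n \<Longrightarrow> i < n \<Longrightarrow> x i * x i = 1"
  using cube_coord[of x n i] by auto

lemma cube_mean_flip_on:
  assumes "S \<subseteq> {..<n}"
  shows "cube_mean n (\<lambda>x. F (flip_on S x)) = cube_mean n F"
proof -
  have "bij_betw (flip_on S) (cube n) (cube n)"
    by (rule bij_betwI[where g = "flip_on S"]) (auto simp: flip_on_cube[OF assms])
  then show ?thesis
    unfolding cube_mean_def by (simp add: sum.reindex_bij_betw)
qed

lemma cube_mean_odd:
  assumes "S \<subseteq> {..<n}" "\<And>x. x \<in> cube n \<Longrightarrow> F (flip_on S x) = - F x"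
  shows "cube_mean n F = 0"
proof -
  have "cube_mean n F = cube_mean n (\<lambda>x. - F x)"
    using cube_mean_flip_on[OF assms(1), of F] cube_mean_cong[of n "\<lambda>x. F (flip_on S x)" "\<lambda>x. - F x"] assms(2)
    by simp
  then show ?thesis by (simp add: cube_mean_minus)
qed

text \<open>Flipping \<open>S\<close> preserves the uniform law, so averaging the mean with its
  flipped version trades \<open>F\<close> for its change under the flip.\<close>

lemma cube_mean_symmetrize:
  assumes "S \<subseteq> {..<n}" "\<And>x. x \<in> cube n \<Longrightarrow> Y (flip_on S x) = - Y x"
  shows "cube_mean n (\<lambda>x. F x * Y x) = cube_mean n (\<lambda>x. (F x - F (flip_on S x)) * Y x) / 2"
proof -
  have "cube_mean n (\<lambda>x. F x * Y x) = cube_mean n (\<lambda>x. F (flip_on S x) * Y (flip_on S x))"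
    using cube_mean_flip_on[OF assms(1), of "\<lambda>x. F x * Y x"] by simp
  also have "\<dots> = cube_mean n (\<lambda>x. - (F (flip_on S x) * Y x))"
    by (rule cube_mean_cong) (simp add: assms(2))
  finally show ?thesis
    by (simp add: left_diff_distrib cube_mean_diff cube_mean_minus)
qed

text \<open>Swapping the coordinates outside \<open>S\<close> of two independent points preserves their joint law,
  and turns \<open>F x * G y\<close> into a function of a single point.\<close>
lemma cube_mean_indep:
  assumes F: "\<And>x y. x \<in> cube n \<Longrightarrow> y \<in> cube n \<Longrightarrow> (\<And>i. i \<in> S \<Longrightarrow> x i = y i) \<Longrightarrow> F x = F y"
    and G: "\<And>x y. x \<in> cube n \<Longrightarrow> y \<in> cube n \<Longrightarrow> (\<And>i. i \<in> T \<Longrightarrow> x i = y i) \<Longrightarrow> G x = G y"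
    and disj: "S \<inter> T = {}"
  shows "cube_mean n (\<lambda>x. F x * G x) = cube_mean n F * cube_mean n G"
proof -
  define mix where "mix x y = (\<lambda>i. if i \<in> S then x i else y i)" for x y :: "nat \<Rightarrow> real"
  define sw where "sw = (\<lambda>(x, y). (mix x y, mix y x))"
  let ?C = "cube n"
  have mix: "mix x y \<in> ?C" if "x \<in> ?C" "y \<in> ?C" for x y
    using that unfolding cube_def mix_def by (auto simp: PiE_iff extensional_def)
  have swsw: "sw (sw p) = p" for p
    by (auto simp: sw_def mix_def split: prod.splits)
  have "bij_betw sw (?C \<times> ?C) (?C \<times> ?C)"
    by (rule bij_betwI[where g = sw]) (auto simp: swsw, auto simp: sw_def mix)
  then have "(\<Sum>p\<in>?C \<times> ?C. F (fst p) * G (fst p)) = (\<Sum>p\<in>?C \<times> ?C. F (fst (sw p)) * G (fst (sw p)))"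
    by (simp add: sum.reindex_bij_betw[where g = "\<lambda>p. F (fst p) * G (fst p)"])
  also have "\<dots> = (\<Sum>p\<in>?C \<times> ?C. F (fst p) * G (snd p))"
  proof (rule sum.cong[OF refl], clarify)
    fix x y assume xy: "x \<in> ?C" "y \<in> ?C"
    have "F (mix x y) = F x" by (rule F[OF mix[OF xy] xy(1)]) (simp add: mix_def)
    moreover have "G (mix x y) = G y"
      using disj by (intro G[OF mix[OF xy] xy(2)]) (auto simp: mix_def)
    ultimately show "F (fst (sw (x, y))) * G (fst (sw (x, y))) = F (fst (x, y)) * G (snd (x, y))"
      by (simp add: sw_def)
  qed
  also have "\<dots> = (\<Sum>x\<in>?C. F x) * (\<Sum>y\<in>?C. G y)"
    by (simp add: sum_product sum.cartesian_product case_prod_beta)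
  finally have "real (card ?C) * (\<Sum>x\<in>?C. F x * G x) = (\<Sum>x\<in>?C. F x) * (\<Sum>y\<in>?C. G y)"
    by (simp add: sum.cartesian_product' sum_distrib_left)
  then show ?thesis
    using card_cube_pos[of n] by (simp add: cube_mean_def field_simps)
qed

section \<open>Linear forms\<close>

definition lin :: "(nat \<Rightarrow> real) \<Rightarrow> nat set \<Rightarrow> (nat \<Rightarrow> real) \<Rightarrow> real" where
  "lin w S x = (\<Sum>i\<in>S. w i * x i)"

text \<open>The variance of \<open>lin w S x\<close> for uniform \<open>x\<close>.\<close>

definition energy :: "(nat \<Rightarrow> real) \<Rightarrow> nat set \<Rightarrow> real" where
  "energy w S = (\<Sum>i\<in>S. (w i)\<^sup>2)"

lemma energy_nonneg: "energy w S \<ge> 0"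
  by (simp add: energy_def sum_nonneg)

lemma energy_mono: "finite T \<Longrightarrow> S \<subseteq> T \<Longrightarrow> energy w S \<le> energy w T"
  unfolding energy_def by (rule sum_mono2) auto

lemma lin_cong: "(\<And>i. i \<in> S \<Longrightarrow> x i = y i) \<Longrightarrow> lin w S x = lin w S y"
  by (simp add: lin_def)

lemma lin_flip_on_subset:
  assumes "finite U" "S \<subseteq> U"
  shows "lin w U (flip_on S x) = lin w U x - 2 * lin w S x"
proof -
  have "lin w U (flip_on S x) = lin w (U - S) (flip_on S x) + lin w S (flip_on S x)"
    unfolding lin_def using assms by (intro sum.subset_diff)
  also have "\<dots> = lin w (U - S) x - lin w S x"
    by (simp add: lin_def flip_on_def sum_negf)
  also have "lin w (U - S) x = lin w U x - lin w S x"
    unfolding lin_def using assms by (subst sum.subset_diff[of S U]) auto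
  finally show ?thesis by simp
qed

lemma lin_flip_on_self: "lin w S (flip_on S x) = - lin w S x"
  by (simp add: lin_def flip_on_def sum_negf)

lemma lin_flip_on_disjoint: "S \<inter> U = {} \<Longrightarrow> lin w U (flip_on S x) = lin w U x"
  by (rule lin_cong) (auto simp: flip_on_def)

text \<open>Coordinates are added one at a time, and terms odd in the new one average to zero. With
  \<open>e\<close> the old energy and \<open>a\<close> the new weight, the fourth moment grows by
  \<open>6 a^2 e + a^4\<close>, while \<open>3 (e + a^2)^2\<close> has room for
  \<open>6 a^2 e + 3 a^4\<close>.\<close>

lemma cube_mean_lin_moments:
  assumes "S \<subseteq> {..<n}"
  shows "cube_mean n (\<lambda>x. (lin w S x)\<^sup>2) = energy w S
    \<and> cube_mean n (\<lambda>x. (lin w S x) ^ 4) \<le> 3 * (energy w S)\<^sup>2"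
proof -
  have "finite S" using assms finite_subset by blast
  then show ?thesis
    using assms
  proof (induction S)
    case empty
    then show ?case by (simp add: lin_def energy_def)
  next
    case (insert i S)
    let ?u = "lin w S" and ?a = "w i"
    have i: "{i} \<subseteq> {..<n}" using insert.prems by auto
    have flip_u: "?u (flip_on {i} x) = ?u x" for x
      using insert.hyps by (intro lin_flip_on_disjoint) auto
    have lin: "lin w (insert i S) x = ?u x + ?a * x i" for x
      using insert.hyps by (simp add: lin_def)
    have sq: "x i * x i = 1" if "x \<in> cube n" for x
      using that i by (intro cube_coord_square) auto
    have odd: "cube_mean n (\<lambda>x. x i * F (?u x)) = 0" for F
      by (rule cube_mean_odd[OF i]) (simp add: flip_u, simp add: flip_on_def)
    have "cube_mean n (\<lambda>x. (lin w (insert i S) x)\<^sup>2)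
        = cube_mean n (\<lambda>x. (?u x)\<^sup>2 + ?a\<^sup>2 + 2 * ?a * (x i * ?u x))"
    proof (rule cube_mean_cong)
      fix x assume "x \<in> cube n"
      show "(lin w (insert i S) x)\<^sup>2 = (?u x)\<^sup>2 + ?a\<^sup>2 + 2 * ?a * (x i * ?u x)"
        unfolding lin using sq[OF \<open>x \<in> cube n\<close>] by algebra
    qed
    also have "\<dots> = energy w (insert i S)"
      using insert odd[of "\<lambda>t. t"] by (simp add: cube_mean_add cube_mean_cmult energy_def)
    finally have m2: "cube_mean n (\<lambda>x. (lin w (insert i S) x)\<^sup>2) = energy w (insert i S)" .
    have "cube_mean n (\<lambda>x. (lin w (insert i S) x) ^ 4)
        = cube_mean n (\<lambda>x. (?u x) ^ 4 + 6 * ?a\<^sup>2 * (?u x)\<^sup>2 + ?a ^ 4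
            + 4 * ?a * (x i * (?u x) ^ 3) + 4 * ?a ^ 3 * (x i * ?u x))"
    proof (rule cube_mean_cong)
      fix x assume "x \<in> cube n"
      show "(lin w (insert i S) x) ^ 4 = (?u x) ^ 4 + 6 * ?a\<^sup>2 * (?u x)\<^sup>2 + ?a ^ 4
            + 4 * ?a * (x i * (?u x) ^ 3) + 4 * ?a ^ 3 * (x i * ?u x)"
        unfolding lin using sq[OF \<open>x \<in> cube n\<close>] by algebra
    qed
    also have "\<dots> = cube_mean n (\<lambda>x. (?u x) ^ 4) + 6 * ?a\<^sup>2 * energy w S + ?a ^ 4"
      using insert odd[of "\<lambda>t. t"] odd[of "\<lambda>t. t ^ 3"]
      by (simp add: cube_mean_add cube_mean_cmult)
    also have "\<dots> \<le> 3 * (energy w S)\<^sup>2 + 6 * ?a\<^sup>2 * energy w S + 3 * ?a ^ 4"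
    proof -
      have "cube_mean n (\<lambda>x. (?u x) ^ 4) \<le> 3 * (energy w S)\<^sup>2" using insert by simp
      moreover have "0 \<le> ?a ^ 4" by simp
      ultimately show ?thesis by linarith
    qed
    also have "\<dots> = 3 * (energy w (insert i S))\<^sup>2"
      using insert.hyps by (simp add: energy_def power2_eq_square power4_eq_xxxx algebra_simps)
    finally show ?case using m2 by blast
  qed
qed

text \<open>Paley--Zygmund: for \<open>s = (lin w S x)\<^sup>2 / energy w S\<close>, the polynomial \<open>s - s\<^sup>2 / 5 - 1/4\<close> is at most 1,
  is nonpositive for \<open>s \<le> 1/4\<close>, and has mean at least \<open>1 - 3/5 - 1/4\<close>.\<close>
lemma prob_lin_large:
  assumes "S \<subseteq> {..<n}" and r: "4 * r\<^sup>2 \<le> energy w S" "r \<ge> 0"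
  shows "cube_mean n (\<lambda>x. of_bool (r \<le> \<bar>lin w S x\<bar>)) \<ge> 3/20"
proof (cases "energy w S = 0")
  case True
  then have "r = 0" using r by simp
  then show ?thesis by simp
next
  case False
  define e where "e = energy w S"
  have e: "e > 0" using False energy_nonneg[of w S] by (simp add: e_def)
  let ?u = "lin w S"
  have "cube_mean n (\<lambda>x. (?u x)\<^sup>2 / e - (?u x) ^ 4 / (5 * e\<^sup>2) - 1/4) =
      cube_mean n (\<lambda>x. (?u x)\<^sup>2) / e - cube_mean n (\<lambda>x. (?u x) ^ 4) / (5 * e\<^sup>2) - 1/4"
    by (simp only: cube_mean_diff cube_mean_divide cube_mean_const)
  also have "\<dots> \<ge> 1 - 3/5 - 1/4"
  proof -
    have "cube_mean n (\<lambda>x. (?u x) ^ 4) / (5 * e\<^sup>2) \<le> 3/5"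
      using cube_mean_lin_moments[OF assms(1), of w] e
      by (simp add: e_def[symmetric] divide_simps)
    then show ?thesis
      using cube_mean_lin_moments[OF assms(1), of w] e by (simp add: e_def[symmetric])
  qed
  finally have "3/20 \<le> cube_mean n (\<lambda>x. (?u x)\<^sup>2 / e - (?u x) ^ 4 / (5 * e\<^sup>2) - 1/4)" by simp
  also have "\<dots> \<le> cube_mean n (\<lambda>x. of_bool (r \<le> \<bar>?u x\<bar>))"
  proof (rule cube_mean_mono)
    fix x
    define s where "s = (?u x)\<^sup>2 / e"
    have s4: "(?u x) ^ 4 / (5 * e\<^sup>2) = s\<^sup>2 / 5"
      by (simp add: s_def power_divide)
    \<comment> \<open>The maximum of \<open>s - s^2 / 5\<close> is 5/4, attained at
      \<open>s = 5/2\<close>.\<close>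
    have 1: "s - s\<^sup>2 / 5 - 1/4 \<le> 1"
      using zero_le_power2[of "s - 5/2"] by (simp add: power2_eq_square algebra_simps)
    have 2: "s - s\<^sup>2 / 5 - 1/4 \<le> 0" if "\<not> r \<le> \<bar>?u x\<bar>"
    proof -
      have "(?u x)\<^sup>2 \<le> r\<^sup>2" using that r(2) by (simp add: abs_le_square_iff[symmetric])
      then have "s \<le> 1/4" using r(1) e by (simp add: s_def e_def[symmetric] divide_simps)
      moreover have "s\<^sup>2 / 5 \<ge> 0" by simp
      ultimately show ?thesis by linarith
    qed
    show "(?u x)\<^sup>2 / e - (?u x) ^ 4 / (5 * e\<^sup>2) - 1/4 \<le> of_bool (r \<le> \<bar>?u x\<bar>)"
      unfolding s4 using 1 2 by (simp add: s_def[symmetric])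
  qed
  finally show ?thesis .
qed

lemma chebyshev_lin:
  assumes "S \<subseteq> {..<n}" "r > 0"
  shows "cube_mean n (\<lambda>x. of_bool (r \<le> \<bar>lin w S x\<bar>)) \<le> energy w S / r\<^sup>2"
proof -
  have "cube_mean n (\<lambda>x. of_bool (r \<le> \<bar>lin w S x\<bar>)) \<le> cube_mean n (\<lambda>x. (lin w S x)\<^sup>2 / r\<^sup>2)"
  proof (rule cube_mean_mono)
    fix x
    have "r\<^sup>2 \<le> (lin w S x)\<^sup>2" if "r \<le> \<bar>lin w S x\<bar>"
      using that assms(2) by (simp add: abs_le_square_iff[symmetric])
    then show "of_bool (r \<le> \<bar>lin w S x\<bar>) \<le> (lin w S x)\<^sup>2 / r\<^sup>2"
      using assms(2) by auto
  qed
  then show ?thesis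
    using cube_mean_lin_moments[OF assms(1), of w] by (simp add: cube_mean_divide)
qed

section \<open>Anticoncentration from blocks\<close>

text \<open>A Littlewood--Offord bound. Let \<open>st L\<close> be the monotone step function of \<open>L = lin w U x - \<theta>\<close>
  that vanishes exactly for \<open>\<bar>L\<bar> < r\<close>. Flipping a block with sum \<open>s\<close>, \<open>\<bar>s\<bar> \<ge> r\<close>, moves \<open>L\<close> out of the
  window, so \<open>st L\<close> correlates with each \<open>sgn s\<close>; but the signs are uncorrelated, so the total
  correlation is at most the square root of the number of blocks.\<close>
lemma anticoncentration_blocks:
  fixes m :: nat
  assumes U: "U \<subseteq> {..<n}"
    and sub: "\<And>j. j < m \<Longrightarrow> Bk j \<subseteq> U"
    and disj: "\<And>i j. i < m \<Longrightarrow> j < m \<Longrightarrow> i \<noteq> j \<Longrightarrow> Bk i \<inter> Bk j = {}"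
    and r: "r \<ge> 0" "\<And>j. j < m \<Longrightarrow> 4 * r\<^sup>2 \<le> energy w (Bk j)"
    and m: "m > 0"
  shows "cube_mean n (\<lambda>x. of_bool (\<bar>lin w U x - \<theta>\<bar> < r)) \<le> 20 / sqrt m"
proof -
  define L where "L x = lin w U x - \<theta>" for x
  define s where "s j x = lin w (Bk j) x" for j x
  define A :: "(nat \<Rightarrow> real) \<Rightarrow> real" where "A x = of_bool (\<bar>L x\<bar> < r)" for x
  define N :: "nat \<Rightarrow> (nat \<Rightarrow> real) \<Rightarrow> real" where "N j x = of_bool (r \<le> \<bar>s j x\<bar>)" for j x
  define a where "a j = cube_mean n (N j)" for j
  define st where "st t = (if \<bar>t\<bar> < r then 0 else sgn t)" for t :: real
  have finU: "finite U" using U finite_subset by blast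
  have subn: "Bk j \<subseteq> {..<n}" if "j < m" for j using sub[OF that] U by auto
  have s_self: "s j (flip_on (Bk j) x) = - s j x" for j x
    by (simp add: s_def lin_flip_on_self)
  have s_other: "s j (flip_on (Bk i) x) = s j x" if "i < m" "j < m" "i \<noteq> j" for i j x
    unfolding s_def using disj[OF that] by (rule lin_flip_on_disjoint)
  have N_abs: "0 \<le> N j x" "N j x \<le> 1" for j x by (auto simp: N_def)
  have a_ge: "a j \<ge> 3/20" if "j < m" for j
    unfolding a_def N_def s_def using prob_lin_large[OF subn[OF that] r(2)[OF that] r(1)] .
  have a_le: "a j \<le> 1" for j
    unfolding a_def using cube_mean_mono[of n "N j" "\<lambda>x. 1"] N_abs by simp
  have corr: "cube_mean n (\<lambda>x. A x * N j x) \<le> 2 * cube_mean n (\<lambda>x. st (L x) * sgn (s j x))"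
    if j: "j < m" for j
  proof -
    \<comment> \<open>The right side is never negative, as \<open>st\<close> is monotone. If
      \<open>A x = N j x = 1\<close>, then \<open>st (L x) = 0\<close> and the flip moves
      \<open>L\<close> by at least \<open>2 * r\<close>, out of the window on the side opposite to
      \<open>s j x\<close>, which gives the value 1.\<close>
    have "cube_mean n (\<lambda>x. A x * N j x)
        \<le> cube_mean n (\<lambda>x. (st (L x) - st (L (flip_on (Bk j) x))) * sgn (s j x))"
    proof (rule cube_mean_mono)
      fix x
      have "L (flip_on (Bk j) x) = L x - 2 * s j x"
        using lin_flip_on_subset[OF finU sub[OF j]] by (simp add: L_def s_def)
      then show "A x * N j x \<le> (st (L x) - st (L (flip_on (Bk j) x))) * sgn (s j x)"
        using r(1) by (auto simp: A_def N_def st_def sgn_if abs_if split: if_splits)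
    qed
    also have "\<dots> = 2 * cube_mean n (\<lambda>x. st (L x) * sgn (s j x))"
      by (subst cube_mean_symmetrize[OF subn[OF j]]) (auto simp: s_self sgn_minus)
    finally show ?thesis .
  qed
  have 1: "cube_mean n (\<lambda>x. st (L x) * (\<Sum>j<m. sgn (s j x))) \<le> sqrt (card {..<m})"
  proof (rule cube_mean_correlation_le)
    fix i j assume ij: "i \<in> {..<m}" "j \<in> {..<m}" "i \<noteq> j"
    show "cube_mean n (\<lambda>x. sgn (s i x) * sgn (s j x)) = 0"
      using ij by (intro cube_mean_odd[OF subn[of i]]) (auto simp: s_self s_other sgn_minus)
  qed (auto simp: st_def abs_sgn_eq)
  \<comment> \<open>\<open>A\<close> depends on all blocks and is not independent of
    \<open>N j\<close>. Replacing \<open>N j\<close> by its mean still costs only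
    \<open>sqrt m\<close> in total, because the centred indicators of disjoint blocks are
    independent.\<close>
  have 2: "cube_mean n (\<lambda>x. A x * (\<Sum>j<m. a j - N j x)) \<le> sqrt (card {..<m})"
  proof (rule cube_mean_correlation_le)
    fix i j assume ij: "i \<in> {..<m}" "j \<in> {..<m}" "i \<noteq> j"
    have "cube_mean n (\<lambda>x. (a i - N i x) * (a j - N j x))
        = cube_mean n (\<lambda>x. a i - N i x) * cube_mean n (\<lambda>x. a j - N j x)"
    proof (rule cube_mean_indep)
      show "Bk i \<inter> Bk j = {}" using ij disj by auto
      show "a i - N i x = a i - N i y" if "\<And>k. k \<in> Bk i \<Longrightarrow> x k = y k" for x y
        using lin_cong[of "Bk i" x y w] that by (simp add: N_def s_def)
      show "a j - N j x = a j - N j y" if "\<And>k. k \<in> Bk j \<Longrightarrow> x k = y k" for x y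
        using lin_cong[of "Bk j" x y w] that by (simp add: N_def s_def)
    qed
    then show "cube_mean n (\<lambda>x. (a i - N i x) * (a j - N j x)) = 0"
      by (simp add: cube_mean_diff a_def)
  next
    fix j x assume "j \<in> {..<m}"
    then show "\<bar>a j - N j x\<bar> \<le> 1" using N_abs[of j x] a_le[of j] a_ge[of j] by auto
  qed (auto simp: A_def)
  \<comment> \<open>Split \<open>a j\<close> into \<open>a j - N j x\<close> and
    \<open>N j x\<close>: the parts contribute at most \<open>sqrt m\<close> and
    \<open>2 * sqrt m\<close>. Dividing by the sum of the \<open>a j\<close>, at least
    \<open>3 * m / 20\<close>, yields \<open>20 / sqrt m\<close>.\<close>
  have "cube_mean n A * (\<Sum>j<m. a j) = cube_mean n (\<lambda>x. A x * (\<Sum>j<m. a j - N j x) + (\<Sum>j<m. A x * N j x))"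
  proof -
    have "A x * (\<Sum>j<m. a j - N j x) + (\<Sum>j<m. A x * N j x) = (\<Sum>j<m. a j) * A x" for x
      unfolding sum_distrib_left sum_distrib_right sum.distrib[symmetric]
      by (intro sum.cong) (auto simp: algebra_simps)
    then show ?thesis by (simp add: cube_mean_cmult)
  qed
  also have "\<dots> = cube_mean n (\<lambda>x. A x * (\<Sum>j<m. a j - N j x)) + (\<Sum>j<m. cube_mean n (\<lambda>x. A x * N j x))"
    by (simp add: cube_mean_add cube_mean_sum)
  also have "\<dots> \<le> sqrt m + (\<Sum>j<m. 2 * cube_mean n (\<lambda>x. st (L x) * sgn (s j x)))"
    using 2 corr by (intro add_mono sum_mono) auto
  also have "(\<Sum>j<m. 2 * cube_mean n (\<lambda>x. st (L x) * sgn (s j x)))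
      = 2 * cube_mean n (\<lambda>x. st (L x) * (\<Sum>j<m. sgn (s j x)))"
    by (simp add: sum_distrib_left cube_mean_sum)
  also have "\<dots> \<le> 2 * sqrt m" using 1 by simp
  finally have up: "cube_mean n A * (\<Sum>j<m. a j) \<le> 3 * sqrt m" by simp
  have "(\<Sum>j<m. a j) \<ge> (\<Sum>j<m. 3/20)"
    using a_ge by (intro sum_mono) auto
  moreover have "cube_mean n A \<ge> 0"
    using cube_mean_mono[of n "\<lambda>x. 0" A] by (simp add: A_def)
  ultimately have "cube_mean n A * (m * (3/20)) \<le> cube_mean n A * (\<Sum>j<m. a j)"
    by (intro mult_left_mono) auto
  with up have "(cube_mean n A * sqrt m) * sqrt m \<le> 20 * sqrt m"
    by (simp add: mult.assoc)
  then have "cube_mean n A * sqrt m \<le> 20"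
    using m by simp
  then show ?thesis
    using m by (simp add: A_def[abs_def] L_def field_simps)
qed

text \<open>The blocks are the images of consecutive intervals of length \<open>B\<close> under an
  enumeration of \<open>H\<close>.\<close>

lemma split_into_blocks:
  assumes "finite H" "card H = m * B"
  obtains Bk :: "nat \<Rightarrow> 'a set" where
    "\<And>j. j < m \<Longrightarrow> Bk j \<subseteq> H" "\<And>j. j < m \<Longrightarrow> card (Bk j) = B"
    "\<And>i j. i < m \<Longrightarrow> j < m \<Longrightarrow> i \<noteq> j \<Longrightarrow> Bk i \<inter> Bk j = {}"
proof -
  obtain h where h: "bij_betw h {0..<m * B} H"
    using ex_bij_betw_nat_finite[OF assms(1)] assms(2) by auto
  define I where "I j = {j * B..<j * B + B}" for j
  have I: "I j \<subseteq> {0..<m * B}" if "j < m" for j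
  proof -
    have "Suc j * B \<le> m * B" using that by (intro mult_le_mono1) simp
    then show ?thesis by (auto simp: I_def)
  qed
  have inj: "inj_on h {0..<m * B}" using h by (simp add: bij_betw_def)
  have I_disj: "I i \<inter> I j = {}" if "i < j" for i j
  proof -
    have "Suc i * B \<le> j * B" using that by (intro mult_le_mono1) simp
    then show ?thesis by (auto simp: I_def)
  qed
  show ?thesis
  proof (rule that[of "\<lambda>j. h ` I j"])
    show "h ` I j \<subseteq> H" if "j < m" for j
      using I[OF that] h by (auto simp: bij_betw_def)
    show "card (h ` I j) = B" if "j < m" for j
      using card_image[OF inj_on_subset[OF inj I[OF that]]] by (simp add: I_def)
    show "h ` I i \<inter> h ` I j = {}" if "i < m" "j < m" "i \<noteq> j" for i j
      using inj_on_image_Int[OF inj I I, of i j] that I_disj[of i j] I_disj[of j i]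
      by (cases "i < j") (auto simp: Int_commute)
  qed
qed

section \<open>Truncating a threshold function to a head\<close>

text \<open>Symmetrizing in coordinate \<open>i\<close> leaves half the change of \<open>f\<close>,
  which is at most 1 in absolute value and vanishes unless the flip changes
  \<open>f\<close>.\<close>

lemma mean_mult_coord_le_influence:
  assumes "i < n" and f: "\<And>x. x \<in> cube n \<Longrightarrow> \<bar>f x\<bar> \<le> 1"
  shows "\<bar>cube_mean n (\<lambda>x. f x * x i)\<bar> \<le> influence n f i"
proof -
  have i: "{i} \<subseteq> {..<n}" using assms by auto
  let ?D = "\<lambda>x. (f x - f (flip_on {i} x)) * x i"
  have "cube_mean n (\<lambda>x. f x * x i) = cube_mean n ?D / 2"
    by (rule cube_mean_symmetrize[OF i]) (simp add: flip_on_def)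
  moreover have bd: "\<bar>?D x\<bar> \<le> 2 * of_bool (f x \<noteq> f (flip i x))" if x: "x \<in> cube n" for x
  proof -
    have "\<bar>x i\<bar> = 1" using cube_coord_square[OF x assms(1)] by (auto simp: square_eq_1_iff)
    then show ?thesis
      using f[OF x] f[OF flip_on_cube[OF i x]] by (auto simp: flip_eq_flip_on abs_mult)
  qed
  have "cube_mean n ?D \<le> cube_mean n (\<lambda>x. 2 * of_bool (f x \<noteq> f (flip i x)))"
    using bd by (intro cube_mean_mono) (meson abs_le_D1)
  moreover have "- cube_mean n ?D \<le> cube_mean n (\<lambda>x. 2 * of_bool (f x \<noteq> f (flip i x)))"
    unfolding cube_mean_minus[symmetric] using bd by (intro cube_mean_mono) (meson abs_le_D2)
  ultimately show ?thesis
    by (simp add: influence_def prob_cube_eq_mean cube_mean_cmult)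
qed

lemma influence_nonneg: "influence n f i \<ge> 0"
  by (simp add: influence_def)

lemma mean_mult_lin_le_total_influence:
  assumes T: "T \<subseteq> {..<n}" and f: "\<And>x. x \<in> cube n \<Longrightarrow> \<bar>f x\<bar> \<le> 1"
    and w: "\<And>i. i \<in> T \<Longrightarrow> \<bar>w i\<bar> \<le> c" and c: "c \<ge> 0"
  shows "cube_mean n (\<lambda>x. f x * lin w T x) \<le> c * total_influence n f"
proof -
  have "cube_mean n (\<lambda>x. f x * lin w T x) = (\<Sum>i\<in>T. w i * cube_mean n (\<lambda>x. f x * x i))"
    by (simp add: lin_def sum_distrib_left cube_mean_sum cube_mean_cmult[symmetric] mult.left_commute)
  also have "\<dots> \<le> (\<Sum>i\<in>T. c * influence n f i)"
  proof (rule sum_mono)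
    fix i assume i: "i \<in> T"
    have "w i * cube_mean n (\<lambda>x. f x * x i) \<le> \<bar>w i\<bar> * \<bar>cube_mean n (\<lambda>x. f x * x i)\<bar>"
      by (metis abs_ge_self abs_mult)
    also have "\<dots> \<le> c * influence n f i"
      using i T w[OF i] c by (intro mult_mono mean_mult_coord_le_influence f) auto
    finally show "w i * cube_mean n (\<lambda>x. f x * x i) \<le> c * influence n f i" .
  qed
  also have "\<dots> \<le> (\<Sum>i<n. c * influence n f i)"
    using T c by (intro sum_mono2) (auto simp: influence_nonneg)
  finally show ?thesis by (simp add: total_influence_def sum_distrib_left)
qed

text \<open>With \<open>v\<close> the head and \<open>u\<close> the tail of the affine form, flipping the whole tail turns
  \<open>E[f u]\<close> into the mean of \<open>\<bar>u\<bar>\<close> over the points where \<open>v + u\<close> and \<open>v - u\<close> have different signs.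
  This event contains the disagreement of \<open>f\<close> with the head, and on it \<open>\<bar>u\<bar>\<close> is typically
  of the order of its standard deviation, while regularity bounds \<open>E[f u]\<close> by the influence.\<close>
lemma truncate_regular_tail:
  assumes H: "H \<subseteq> {..<n}" and T: "T = {..<n} - H"
    and f: "\<And>x. x \<in> cube n \<Longrightarrow> f x = pm_sign (lin w {..<n} x - \<theta>)"
    and reg: "\<And>i. i \<in> T \<Longrightarrow> \<bar>w i\<bar> \<le> \<tau> * sqrt (energy w T)" and \<tau>: "\<tau> \<ge> 0"
  shows "cube_mean n (\<lambda>x. of_bool (f x \<noteq> pm_sign (lin w H x - \<theta>))) \<le> 16 * \<tau> * total_influence n f"
proof -
  define u where "u = lin w T"
  define v where "v x = lin w H x - \<theta>" for x
  define \<sigma> where "\<sigma> = sqrt (energy w T)"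
  have Tn: "T \<subseteq> {..<n}" "H \<inter> T = {}" using T by auto
  have \<sigma>: "\<sigma> \<ge> 0" "\<sigma>\<^sup>2 = energy w T" by (simp_all add: \<sigma>_def energy_nonneg)
  have fuv: "f x = pm_sign (v x + u x)" if "x \<in> cube n" for x
  proof -
    have "lin w {..<n} x = lin w T x + lin w H x"
      unfolding lin_def T using H by (intro sum.subset_diff) auto
    then show ?thesis using f[OF that] by (simp add: u_def v_def algebra_simps)
  qed
  have flip_u: "u (flip_on T x) = - u x" for x by (simp add: u_def lin_flip_on_self)
  have flip_v: "v (flip_on T x) = v x" for x
    using Tn(2) by (simp add: v_def lin_flip_on_disjoint Int_commute)
  define D where "D x \<longleftrightarrow> pm_sign (v x + u x) \<noteq> pm_sign (v x - u x)" for x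
  let ?I = "total_influence n f"
  have I: "?I \<ge> 0" by (simp add: total_influence_def sum_nonneg influence_nonneg)
  have fu: "cube_mean n (\<lambda>x. f x * u x) = cube_mean n (\<lambda>x. of_bool (D x) * \<bar>u x\<bar>)"
  proof -
    have "cube_mean n (\<lambda>x. f x * u x) = cube_mean n (\<lambda>x. (f x - f (flip_on T x)) * u x) / 2"
      using Tn(1) by (intro cube_mean_symmetrize) (auto simp: flip_u)
    also have "\<dots> = cube_mean n (\<lambda>x. (f x - f (flip_on T x)) * u x / 2)"
      by (simp add: cube_mean_divide)
    also have "\<dots> = cube_mean n (\<lambda>x. of_bool (D x) * \<bar>u x\<bar>)"
    proof (rule cube_mean_cong)
      fix x assume x: "x \<in> cube n"
      have "f (flip_on T x) = pm_sign (v x - u x)"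
        using fuv[OF flip_on_cube[OF Tn(1) x]] by (simp add: flip_u flip_v)
      \<comment> \<open>On \<open>D\<close> the larger of \<open>v x + u x\<close> and
        \<open>v x - u x\<close> is the nonnegative one, so \<open>f\<close> changes by 2 with the
        sign of \<open>u x\<close>; off \<open>D\<close> it does not change.\<close>
      then show "(f x - f (flip_on T x)) * u x / 2 = of_bool (D x) * \<bar>u x\<bar>"
        using fuv[OF x] by (auto simp: D_def pm_sign_def)
    qed
    finally show ?thesis .
  qed
  have "cube_mean n (\<lambda>x. f x * u x) \<le> (\<tau> * \<sigma>) * ?I"
    unfolding u_def using reg \<tau> \<sigma> fuv
    by (intro mean_mult_lin_le_total_influence[OF Tn(1)]) (auto simp: \<sigma>_def pm_sign_def)
  with fu have up: "cube_mean n (\<lambda>x. of_bool (D x) * \<bar>u x\<bar>) \<le> \<tau> * \<sigma> * ?I" by simp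
  have diff: "f x \<noteq> pm_sign (v x) \<Longrightarrow> D x" if "x \<in> cube n" for x
    using fuv[OF that] by (auto simp: D_def pm_sign_def split: if_splits)
  show ?thesis
  proof (cases "\<sigma> = 0")
    case True
    then have "w i = 0" if "i \<in> T" for i using reg[OF that] by (simp add: \<sigma>_def)
    then have "u x = 0" for x by (simp add: u_def lin_def)
    then have "\<not> D x" for x by (simp add: D_def)
    then have "cube_mean n (\<lambda>x. of_bool (f x \<noteq> pm_sign (v x))) \<le> cube_mean n (\<lambda>x. 0)"
      using diff by (intro cube_mean_mono) auto
    moreover have "0 \<le> 16 * \<tau> * ?I" using I \<tau> by simp
    ultimately show ?thesis by (simp add: v_def)
  next
    case False
    then have \<sigma>0: "\<sigma> > 0" using \<sigma> by simp
    define V :: "(nat \<Rightarrow> real) \<Rightarrow> real" where "V x = of_bool (\<bar>v x\<bar> < \<sigma> / 2)" for x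
    define N :: "(nat \<Rightarrow> real) \<Rightarrow> real" where "N x = of_bool (\<sigma> / 2 \<le> \<bar>u x\<bar>)" for x
    let ?d = "cube_mean n (\<lambda>x. of_bool (D x) * N x)"
    \<comment> \<open>Head and tail are independent, and \<open>V\<close> together with
      \<open>N\<close> forces \<open>\<bar>v x\<bar> < \<bar>u x\<bar>\<close>, hence
      \<open>D\<close>. So a head near the threshold is charged to \<open>D\<close> with a large
      tail.\<close>
    have "cube_mean n V * (3/20) \<le> cube_mean n V * cube_mean n N"
    proof (rule mult_left_mono)
      show "3/20 \<le> cube_mean n N"
        unfolding N_def u_def using \<sigma> Tn(1) by (intro prob_lin_large) (auto simp: power_divide)
      show "0 \<le> cube_mean n V"
        using cube_mean_mono[of n "\<lambda>x. 0" V] by (simp add: V_def)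
    qed
    also have "\<dots> = cube_mean n (\<lambda>x. V x * N x)"
    proof (rule cube_mean_indep[symmetric])
      show "H \<inter> T = {}" by fact
      show "V x = V y" if "\<And>k. k \<in> H \<Longrightarrow> x k = y k" for x y
        using lin_cong[of H x y w] that by (simp add: V_def v_def)
      show "N x = N y" if "\<And>k. k \<in> T \<Longrightarrow> x k = y k" for x y
        using lin_cong[of T x y w] that by (simp add: N_def u_def)
    qed
    also have "\<dots> \<le> ?d"
      by (rule cube_mean_mono) (auto simp: V_def N_def D_def pm_sign_def abs_if split: if_splits)
    finally have V: "cube_mean n V \<le> 20/3 * ?d" by simp
    \<comment> \<open>A disagreement implies \<open>D\<close>, hence
      \<open>\<bar>v x\<bar> \<le> \<bar>u x\<bar>\<close>: either \<open>v x\<close> is below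
      \<open>\<sigma> / 2\<close> in absolute value or \<open>u x\<close> is not. The constant 16
      arises as 8, from 20/3 + 1, times 2, from Markov at \<open>\<sigma> / 2\<close>.\<close>
    have "cube_mean n (\<lambda>x. of_bool (f x \<noteq> pm_sign (v x))) \<le> cube_mean n (\<lambda>x. V x + of_bool (D x) * N x)"
    proof (rule cube_mean_mono)
      fix x assume x: "x \<in> cube n"
      have "\<bar>v x\<bar> \<le> \<bar>u x\<bar>" if "D x"
        using that by (auto simp: D_def pm_sign_def abs_if split: if_splits)
      then show "of_bool (f x \<noteq> pm_sign (v x)) \<le> V x + of_bool (D x) * N x"
        using diff[OF x] by (cases "D x") (auto simp: V_def N_def)
    qed
    also have "\<dots> \<le> 8 * ?d"
    proof -
      have "?d \<ge> 0" using cube_mean_mono[of n "\<lambda>x. 0" "\<lambda>x. of_bool (D x) * N x"] by (simp add: N_def)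
      then show ?thesis using V by (simp add: cube_mean_add)
    qed
    also have "?d \<le> cube_mean n (\<lambda>x. 2 / \<sigma> * (of_bool (D x) * \<bar>u x\<bar>))"
      using \<sigma>0 by (intro cube_mean_mono) (auto simp: N_def field_simps)
    also have "\<dots> \<le> 2 / \<sigma> * (\<tau> * \<sigma> * ?I)"
      unfolding cube_mean_cmult using up \<sigma>0 by (intro mult_left_mono) auto
    finally show ?thesis using \<sigma>0 by (simp add: v_def)
  qed
qed

lemma truncate_heavy_head:
  assumes H: "H \<subseteq> {..<n}" and T: "T = {..<n} - H"
    and f: "\<And>x. x \<in> cube n \<Longrightarrow> f x = pm_sign (lin w {..<n} x - \<theta>)"
    and card: "card H = m * B"
    and heavy: "\<And>i. i \<in> H \<Longrightarrow> \<tau>\<^sup>2 * energy w T \<le> (w i)\<^sup>2"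
    and \<epsilon>: "\<epsilon> > 0" and m: "1600 / \<epsilon>\<^sup>2 \<le> m" and B: "8 / \<epsilon> \<le> B * \<tau>\<^sup>2"
    and pos: "energy w T > 0"
  shows "cube_mean n (\<lambda>x. of_bool (f x \<noteq> pm_sign (lin w H x - \<theta>))) \<le> \<epsilon>"
proof -
  \<comment> \<open>This \<open>r\<close> makes the Chebyshev bound for the tail exactly
    \<open>\<epsilon> / 2\<close>. The hypothesis on \<open>B\<close> then gives each block energy
    at least \<open>4 * r^2\<close>, and the one on \<open>m\<close> makes
    \<open>20 / sqrt m\<close> at most \<open>\<epsilon> / 2\<close>.\<close>
  define r where "r = sqrt (2 / \<epsilon> * energy w T)"
  have r: "r > 0" "r\<^sup>2 = 2 / \<epsilon> * energy w T" using \<epsilon> pos by (simp_all add: r_def)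
  have m0: "m > 0"
  proof -
    have "1600 / \<epsilon>\<^sup>2 > 0" using \<epsilon> by simp
    then have "real m > 0" using m by linarith
    then show ?thesis by simp
  qed
  have Tn: "T \<subseteq> {..<n}" using T by auto
  have finH: "finite H" using H finite_subset by blast
  obtain Bk where Bk: "\<And>j. j < m \<Longrightarrow> Bk j \<subseteq> H" "\<And>j. j < m \<Longrightarrow> card (Bk j) = B"
    "\<And>i j. i < m \<Longrightarrow> j < m \<Longrightarrow> i \<noteq> j \<Longrightarrow> Bk i \<inter> Bk j = {}"
    using split_into_blocks[OF finH card] by metis
  have "4 * r\<^sup>2 \<le> energy w (Bk j)" if j: "j < m" for j
  proof -
    have "4 * r\<^sup>2 = 8 / \<epsilon> * energy w T" using r by simp
    also have "\<dots> \<le> B * \<tau>\<^sup>2 * energy w T" using B pos by (intro mult_right_mono) auto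
    also have "\<dots> = (\<Sum>i\<in>Bk j. \<tau>\<^sup>2 * energy w T)" using Bk(2)[OF j] by simp
    also have "\<dots> \<le> energy w (Bk j)"
      unfolding energy_def[of w "Bk j"] using Bk(1)[OF j] heavy by (intro sum_mono) auto
    finally show ?thesis .
  qed
  then have "cube_mean n (\<lambda>x. of_bool (\<bar>lin w H x - \<theta>\<bar> < r)) \<le> 20 / sqrt m"
    using r(1) by (intro anticoncentration_blocks[OF H Bk(1) Bk(3) _ _ m0]) auto
  also have "\<dots> \<le> \<epsilon> / 2"
  proof -
    have "40 / \<epsilon> \<le> sqrt m"
      using m by (intro real_le_rsqrt) (simp add: power_divide)
    then show ?thesis using \<epsilon> m0 by (simp add: field_simps)
  qed
  finally have 1: "cube_mean n (\<lambda>x. of_bool (\<bar>lin w H x - \<theta>\<bar> < r)) \<le> \<epsilon> / 2" .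
  have 2: "cube_mean n (\<lambda>x. of_bool (r \<le> \<bar>lin w T x\<bar>)) \<le> \<epsilon> / 2"
    using chebyshev_lin[OF Tn r(1), of w] r(2) \<epsilon> pos by simp
  have "cube_mean n (\<lambda>x. of_bool (f x \<noteq> pm_sign (lin w H x - \<theta>)))
      \<le> cube_mean n (\<lambda>x. of_bool (\<bar>lin w H x - \<theta>\<bar> < r) + of_bool (r \<le> \<bar>lin w T x\<bar>))"
  proof (rule cube_mean_mono)
    fix x assume x: "x \<in> cube n"
    have "lin w {..<n} x = lin w T x + lin w H x"
      unfolding lin_def T using H by (intro sum.subset_diff) auto
    then show "of_bool (f x \<noteq> pm_sign (lin w H x - \<theta>))
        \<le> (of_bool (\<bar>lin w H x - \<theta>\<bar> < r) + of_bool (r \<le> \<bar>lin w T x\<bar>) :: real)"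
      using f[OF x] by (auto simp: pm_sign_def abs_if split: if_splits)
  qed
  also have "\<dots> \<le> \<epsilon>" using 1 2 by (simp add: cube_mean_add)
  finally show ?thesis .
qed

text \<open>Induction on \<open>K\<close>: a head whose tail is not regular absorbs an offending
  coordinate. The tail energy only shrinks, so earlier head weights remain heavy.\<close>

lemma greedy_head:
  fixes w :: "nat \<Rightarrow> real"
  obtains (regular) H where "H \<subseteq> {..<n}" "card H \<le> K"
      "\<And>i. i \<in> {..<n} - H \<Longrightarrow> (w i)\<^sup>2 \<le> \<tau>\<^sup>2 * energy w ({..<n} - H)"
  | (heavy) H where "H \<subseteq> {..<n}" "card H = K" "energy w ({..<n} - H) > 0"
      "\<And>i. i \<in> H \<Longrightarrow> \<tau>\<^sup>2 * energy w ({..<n} - H) \<le> (w i)\<^sup>2"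
proof -
  define R where "R H \<longleftrightarrow> (\<forall>i\<in>{..<n} - H. (w i)\<^sup>2 \<le> \<tau>\<^sup>2 * energy w ({..<n} - H))" for H
  have "(\<exists>H\<subseteq>{..<n}. card H \<le> K \<and> R H) \<or>
      (\<exists>H\<subseteq>{..<n}. card H = K \<and> \<not> R H \<and> (\<forall>i\<in>H. \<tau>\<^sup>2 * energy w ({..<n} - H) \<le> (w i)\<^sup>2))"
  proof (induction K)
    case 0
    show ?case by (cases "R {}") (auto intro!: exI[of _ "{}"])
  next
    case (Suc K)
    then consider "\<exists>H\<subseteq>{..<n}. card H \<le> K \<and> R H"
      | H where "H \<subseteq> {..<n}" "card H = K" "\<not> R H" "\<forall>i\<in>H. \<tau>\<^sup>2 * energy w ({..<n} - H) \<le> (w i)\<^sup>2"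
      by blast
    then show ?case
    proof cases
      case 1
      then show ?thesis by (meson le_SucI)
    next
      case (2 H)
      then obtain k where k: "k \<in> {..<n} - H" "\<tau>\<^sup>2 * energy w ({..<n} - H) \<le> (w k)\<^sup>2"
        unfolding R_def by (metis linear)
      let ?H = "insert k H"
      have "finite H" using 2(1) finite_subset by blast
      then have card: "card ?H = Suc K" using k 2 by simp
      have "energy w ({..<n} - ?H) \<le> energy w ({..<n} - H)" by (rule energy_mono) auto
      then have "\<tau>\<^sup>2 * energy w ({..<n} - ?H) \<le> \<tau>\<^sup>2 * energy w ({..<n} - H)"
        by (intro mult_left_mono) auto
      then have "\<forall>i\<in>?H. \<tau>\<^sup>2 * energy w ({..<n} - ?H) \<le> (w i)\<^sup>2" using k 2(4) by fastforce
      moreover have "?H \<subseteq> {..<n}" using 2(1) k by blast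
      ultimately show ?thesis
        using card by (metis order_refl)
    qed
  qed
  then show ?thesis
  proof (elim disjE exE conjE)
    fix H assume "H \<subseteq> {..<n}" "card H \<le> K" "R H"
    then show ?thesis using regular unfolding R_def by blast
  next
    fix H assume H: "H \<subseteq> {..<n}" "card H = K" "\<not> R H"
      "\<forall>i\<in>H. \<tau>\<^sup>2 * energy w ({..<n} - H) \<le> (w i)\<^sup>2"
    \<comment> \<open>Failure of regularity exhibits a nonzero tail weight, so the tail energy is
      positive.\<close>
    from H(3) obtain k where k: "k \<in> {..<n} - H" "\<not> (w k)\<^sup>2 \<le> \<tau>\<^sup>2 * energy w ({..<n} - H)"
      unfolding R_def by blast
    have "0 \<le> \<tau>\<^sup>2 * energy w ({..<n} - H)" by (simp add: energy_nonneg)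
    then have "0 < (w k)\<^sup>2" using k(2) by linarith
    also have "\<dots> \<le> energy w ({..<n} - H)"
      unfolding energy_def using k(1) by (intro member_le_sum) auto
    finally show ?thesis using heavy H by blast
  qed
qed

section \<open>Assembling the approximating junta\<close>

lemma head_threshold_function:
  assumes "H \<subseteq> {..<n}"
  shows "threshold_function n (\<lambda>x. pm_sign (lin w H x - \<theta>))"
proof -
  have "lin w H x = (\<Sum>i<n. (if i \<in> H then w i else 0) * x i)" for x
    using assms by (auto simp: lin_def sum.If_cases if_distrib[where f = "\<lambda>a. a * _"] Int_absorb1
        intro!: sum.mono_neutral_cong_left cong: if_cong)
  then show ?thesis
    unfolding threshold_function_def by (intro exI[of _ "\<lambda>i. if i \<in> H then w i else 0"] exI[of _ \<theta>]) simp
qed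

lemma head_junta:
  assumes "H \<subseteq> {..<n}" "real (card H) \<le> J"
  shows "junta n J (\<lambda>x. pm_sign (lin w H x - \<theta>))"
  unfolding junta_def using assms by (intro exI[of _ H]) (auto simp: lin_def)

text \<open>Rounding \<open>m\<close> and \<open>B\<close> up to integers costs only a factor 2
  each.\<close>

lemma nat_ceiling_le_double:
  fixes a :: real
  assumes "a \<ge> 1"
  shows "real (nat \<lceil>a\<rceil>) \<le> 2 * a"
  using assms by linarith

lemma threshold_function_approx:
  assumes "threshold_function n f" and \<epsilon>: "0 < \<epsilon>" "\<epsilon> < 1"
  shows "\<exists>g. threshold_function n g \<and> junta n ((total_influence n f)\<^sup>2 * (13107200 / \<epsilon> ^ 5)) g \<and>
     cube_mean n (\<lambda>x. of_bool (f x \<noteq> g x)) \<le> \<epsilon>"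
proof -
  obtain w \<theta> where f: "\<And>x. x \<in> cube n \<Longrightarrow> f x = pm_sign (lin w {..<n} x - \<theta>)"
    using assms(1) unfolding threshold_function_def lin_def by blast
  let ?I = "total_influence n f" and ?g = "\<lambda>H x. pm_sign (lin w H x - \<theta>)"
  have I: "?I \<ge> 0" by (simp add: total_influence_def sum_nonneg influence_nonneg)
  have reg: "cube_mean n (\<lambda>x. of_bool (f x \<noteq> ?g H x)) \<le> \<epsilon>"
    if H: "H \<subseteq> {..<n}" and w: "\<And>i. i \<in> {..<n} - H \<Longrightarrow> (w i)\<^sup>2 \<le> \<tau>\<^sup>2 * energy w ({..<n} - H)"
      and \<tau>: "\<tau> \<ge> 0" "16 * \<tau> * ?I \<le> \<epsilon>" for H \<tau>
  proof -
    have "\<bar>w i\<bar> \<le> \<tau> * sqrt (energy w ({..<n} - H))" if "i \<in> {..<n} - H" for i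
      using real_sqrt_le_mono[OF w[OF that]] \<tau>(1) by (simp add: real_sqrt_mult)
    then show ?thesis
      using truncate_regular_tail[OF H refl f, of \<tau>] \<tau> by force
  qed
  have goal: ?thesis if "H \<subseteq> {..<n}" "real (card H) \<le> ?I\<^sup>2 * (13107200 / \<epsilon> ^ 5)"
    "cube_mean n (\<lambda>x. of_bool (f x \<noteq> ?g H x)) \<le> \<epsilon>" for H
    using head_threshold_function[OF that(1)] head_junta[OF that(1,2)] that(3) by blast
  show ?thesis
  proof (cases "16 * ?I \<le> \<epsilon>")
    case True
    \<comment> \<open>Every weight is at most the norm of all weights, so the empty head is regular
      with \<open>\<tau> = 1\<close>. This case includes \<open>?I = 0\<close>, where the
      \<open>\<tau>\<close> of the other case would divide by zero.\<close>
    have "(w i)\<^sup>2 \<le> 1\<^sup>2 * energy w ({..<n} - {})" if "i \<in> {..<n} - {}" for i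
      using that member_le_sum[of i "{..<n}" "\<lambda>i. (w i)\<^sup>2"] by (simp add: energy_def)
    then show ?thesis
      using True I \<epsilon> by (intro goal[of "{}"] reg[where \<tau> = 1]) auto
  next
    case False
    define \<tau> where "\<tau> = \<epsilon> / (16 * ?I)"
    have I0: "?I > 0" using False \<epsilon> by linarith
    have \<tau>0: "\<tau> > 0" using I0 \<epsilon> by (simp add: \<tau>_def)
    have \<tau>1: "\<tau> \<le> 1" using False I0 by (simp add: \<tau>_def)
    define m where "m = nat \<lceil>1600 / \<epsilon>\<^sup>2\<rceil>"
    define B where "B = nat \<lceil>8 / (\<epsilon> * \<tau>\<^sup>2)\<rceil>"
    have m: "1600 / \<epsilon>\<^sup>2 \<le> m" unfolding m_def by linarith
    have "8 / (\<epsilon> * \<tau>\<^sup>2) \<le> B" unfolding B_def by linarith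
    then have B: "8 / \<epsilon> \<le> B * \<tau>\<^sup>2" using \<epsilon> \<tau>0 by (simp add: field_simps)
    have "real m \<le> 2 * (1600 / \<epsilon>\<^sup>2)"
      unfolding m_def
    proof (rule nat_ceiling_le_double)
      have "\<epsilon>\<^sup>2 \<le> 1" using \<epsilon> by (simp add: power_le_one)
      then show "1 \<le> 1600 / \<epsilon>\<^sup>2" using \<epsilon> by (simp add: field_simps)
    qed
    moreover have "real B \<le> 2 * (8 / (\<epsilon> * \<tau>\<^sup>2))"
      unfolding B_def
    proof (rule nat_ceiling_le_double)
      have "\<epsilon> * \<tau>\<^sup>2 \<le> 1" using \<epsilon> \<tau>0 \<tau>1 by (simp add: mult_le_one power_le_one)
      then show "1 \<le> 8 / (\<epsilon> * \<tau>\<^sup>2)" using \<epsilon> \<tau>0 by (simp add: field_simps)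
    qed
    ultimately have "real m * real B \<le> (2 * (1600 / \<epsilon>\<^sup>2)) * (2 * (8 / (\<epsilon> * \<tau>\<^sup>2)))"
      using \<epsilon> by (intro mult_mono) auto
    \<comment> \<open>Since \<open>1 / \<tau>^2 = 256 * ?I^2 / \<epsilon>^2\<close>, the constant is
      3200 * 16 * 256, and the powers of \<open>1 / \<epsilon>\<close> add up as 2 + 1 + 2.\<close>
    also have "\<dots> = ?I\<^sup>2 * (13107200 / \<epsilon> ^ 5)"
      using \<epsilon> I0 by (simp add: \<tau>_def field_simps power_divide eval_nat_numeral)
    finally have K: "real (m * B) \<le> ?I\<^sup>2 * (13107200 / \<epsilon> ^ 5)" by simp
    show ?thesis
    proof (cases rule: greedy_head[where n = n and w = w and \<tau> = \<tau> and K = "m * B"])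
      case (regular H)
      then have "real (card H) \<le> real (m * B)" by (simp only: of_nat_le_iff)
      then show ?thesis
        using regular K \<tau>0 I0 by (intro goal[of H] reg[where \<tau> = \<tau>]) (auto simp: \<tau>_def)
    next
      case (heavy H)
      show ?thesis
        using heavy K \<epsilon> m B
        by (intro goal[of H] truncate_heavy_head[where \<tau> = \<tau> and m = m and B = B] f refl) auto
    qed
  qed
qed

theorem theorem1:
  shows "\<exists>p :: real poly. \<forall>n\<ge>1. \<forall>f. threshold_function n f \<longrightarrow>
    (\<forall>\<epsilon>::real. 0 < \<epsilon> \<and> \<epsilon> < 1 \<longrightarrow>
      (\<exists>g. threshold_function n g \<and>
           junta n ((total_influence n f)\<^sup>2 * poly p (1 / \<epsilon>)) g \<and>
           measure_pmf.prob (pmf_of_set (cube n)) {x. f x \<noteq> g x} \<le> \<epsilon>))"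
  using threshold_function_approx
  by (intro exI[of _ "monom 13107200 5"]) (simp add: poly_monom power_divide prob_cube_eq_mean)

end
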